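(* Let $a_1,a_2,a_3,a_4>0$, and put $b_r=a_r$ ($r=1,2,3$), $b_4=2a_4$, $\Theta^l_{m,n}:=\sqrt{\frac{b_l}{b_mb_n}}$. On $(S^7=\mathrm{Sp}(2)/\mathrm{Sp}(1),g_{\vec a})$ the spinors $$\psi_0=\tfrac1{\sqrt2}(\omega+iy_1),\quad\psi_1=\tfrac1{\sqrt2}(i\omega+y_1),\quad\psi_2=\tfrac1{\sqrt2}(-1+iy_1\wedge\omega),\quad\psi_3=\tfrac1{\sqrt2}(-i+y_1\wedge\omega),$$ with $\omega=y_2\wedge y_3$, are generalized Killing spinors, $\nabla^{g_{\vec a}}_X\psi_i=A_i(X)\cdot\psi_i$, for the endomorphisms $A_i=\sum_{p=1}^4\lambda_{i,p}\,\mathrm{Id}|_{\mathfrak m_p}$, $i=0,1,2,3$, with eigenvalues $$\lambda_{0,p}=\begin{cases}\frac12(-\Theta^p_{p+1,p+2}+\Theta^{p+1}_{p,p+2}+\Theta^{p+2}_{p,p+1})-(\Theta^4_{p,4}-\Theta^p_{4,4})&p=1,2,3,\\-\frac12(\Theta^1_{4,4}+\Theta^2_{4,4}+\Theta^3_{4,4})&p=4,\end{cases}$$ $$\lambda_{k,p}=\begin{cases}\frac12(-\Theta^p_{p+1,p+2}+\Theta^{p+1}_{p,p+2}+\Theta^{p+2}_{p,p+1})-(\Theta^4_{p,4}-\Theta^p_{4,4})&k=p,\ p=1,2,3,\\\frac12(-\Theta^p_{p+1,p+2}+\Theta^{p+1}_{p,p+2}+\Theta^{p+2}_{p,p+1})+(\Theta^4_{p,4}-\Theta^p_{4,4})&k\ne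 p,\ p=1,2,3,\\\frac12(-\Theta^k_{4,4}+\Theta^{k+1}_{4,4}+\Theta^{k+2}_{4,4})&p=4,\end{cases}$$ for $k=1,2,3$, where the indices $k,k+1,k+2,p,p+1,p+2$ on the right-hand sides are taken modulo 3 in $\{1,2,3\}$.
   Context: Matrices are $2\times2$ over the quaternions: $E_{1,2}$ has $-1$ in position $(1,2)$, $+1$ in $(2,1)$; $F_{1,2}$ has $1$ in both; $F_{i,i}$ has $1$ in $(i,i)$; other entries zero. $B_0(X_1,X_2)=-\mathrm{Re}\,\mathrm{tr}(X_1X_2)$. $\mathfrak h=\mathfrak{sp}(1)=\mathrm{span}\{iF_{2,2},jF_{2,2},kF_{2,2}\}\subset\mathfrak{sp}(2)$, $\mathfrak m=\mathfrak h^{\perp_{B_0}}=\bigoplus_{r=1}^4\mathfrak m_r$ with $\mathfrak m_1=\mathbb RiF_{1,1}$, $\mathfrak m_2=\mathbb RkF_{1,1}$, $\mathfrak m_3=\mathbb RjF_{1,1}$, $\mathfrak m_4=\mathrm{span}_{\mathbb R}\{iF_{1,2},jF_{1,2},kF_{1,2},E_{1,2}\}$; $g_{\vec a}=\sum_{r=1}^4a_rB_0|_{\mathfrak m_r\times\mathfrak m_r}$. Orthonormal basis: $e_1=\frac1{\sqrt{a_1}}iF_{1,1}$, $e_2=-\frac1{\sqrt{a_2}}kF_{1,1}$, $e_3=\frac1{\sqrt{a_3}}jF_{1,1}$, $e_4=\frac1{\sqrt{2a_4}}jF_{1,2}$, $e_5=\frac1{\sqrt{2a_4}}kF_{1,2}$,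 $e_6=\frac1{\sqrt{2a_4}}iF_{1,2}$, $e_7=\frac1{\sqrt{2a_4}}E_{1,2}$. Spin module: $x_j=\frac1{\sqrt2}(e_{2j}-ie_{2j+1})$, $y_j=\frac1{\sqrt2}(e_{2j}+ie_{2j+1})$ ($j=1,2,3$), $\Sigma=\Lambda^\bullet\mathrm{span}_{\mathbb C}\{y_1,y_2,y_3\}$, $e_{2j}\cdot\eta=i(x_j\lrcorner\eta+y_j\wedge\eta)$, $e_{2j+1}\cdot\eta=y_j\wedge\eta-x_j\lrcorner\eta$, $e_1\cdot\eta=i\eta$ (even degree), $-i\eta$ (odd degree), $x_j\lrcorner$ the antiderivation with $x_j\lrcorner y_k=\delta_{jk}$. The spin lift of $e_i\wedge e_j$ ($e_i\mapsto e_j$, $e_j\mapsto-e_i$) is $\frac12e_i\cdot e_j$. Elements of $\Sigma$ annihilated by the spin lifts of $\mathrm{ad}(h)|_{\mathfrak m}$, $h\in\mathfrak h$, are identified with invariant spinor fields (constant equivariant maps); for these, at the origin $\nabla^g_X\psi=\widetilde{\Lambda^g(X)}\cdot\psi$, with $\Lambda^g(X)Y=\frac12[X,Y]_{\mathfrak m}+U(X,Y)$, $2g(U(X,Y),Z)=g([Z,X]_{\mathfrak m},Y)+g(X,[Z,Y]_{\mathfrak m})$. Generalized Killing means $\nabla^g_X\psi=A(X)\cdot\psi$ with $A$ symmetric. *)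

theory Defs
  imports "HOL-Analysis.Analysis"
begin

subsection \<open>Quaternions\<close>

codatatype quat = Quat (qre: real) (qi: real) (qj: real) (qk: real)

lemma quat_eqI: "qre p = qre q \<Longrightarrow> qi p = qi q \<Longrightarrow> qj p = qj q \<Longrightarrow> qk p = qk q \<Longrightarrow> p = q"
  by (rule quat.expand) simp

lemma quat_eq_iff: "p = q \<longleftrightarrow> qre p = qre q \<and> qi p = qi q \<and> qj p = qj q \<and> qk p = qk q"
  by (auto intro: quat_eqI)

instantiation quat :: real_algebra_1
begin

primcorec zero_quat where "qre 0 = 0" | "qi 0 = 0" | "qj 0 = 0" | "qk 0 = 0"

primcorec one_quat where "qre 1 = 1" | "qi 1 = 0" | "qj 1 = 0" | "qk 1 = 0"

primcorec plus_quat where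
  "qre (p + q) = qre p + qre q"
| "qi (p + q) = qi p + qi q"
| "qj (p + q) = qj p + qj q"
| "qk (p + q) = qk p + qk q"

primcorec uminus_quat where
  "qre (- p) = - qre p" | "qi (- p) = - qi p" | "qj (- p) = - qj p" | "qk (- p) = - qk p"

primcorec minus_quat where
  "qre (p - q) = qre p - qre q"
| "qi (p - q) = qi p - qi q"
| "qj (p - q) = qj p - qj q"
| "qk (p - q) = qk p - qk q"

primcorec times_quat where
  "qre (p * q) = qre p * qre q - qi p * qi q - qj p * qj q - qk p * qk q"
| "qi (p * q) = qre p * qi q + qi p * qre q + qj p * qk q - qk p * qj q"
| "qj (p * q) = qre p * qj q - qi p * qk q + qj p * qre q + qk p * qi q"
| "qk (p * q) = qre p * qk q + qi p * qj q - qj p * qi q + qk p * qre q"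

primcorec scaleR_quat where
  "qre (scaleR c q) = c * qre q"
| "qi (scaleR c q) = c * qi q"
| "qj (scaleR c q) = c * qj q"
| "qk (scaleR c q) = c * qk q"

instance
  by standard (simp_all add: quat_eq_iff algebra_simps)

end

definition quat_i :: quat where "quat_i = Quat 0 1 0 0"
definition quat_j :: quat where "quat_j = Quat 0 0 1 0"
definition quat_k :: quat where "quat_k = Quat 0 0 0 1"

definition quat_cnj :: "quat \<Rightarrow> quat" where
  "quat_cnj q = Quat (qre q) (- qi q) (- qj q) (- qk q)"

lemma quat_units:
  "quat_i * quat_i = - 1" "quat_j * quat_j = - 1" "quat_k * quat_k = - 1"
  "quat_i * quat_j = quat_k" "quat_j * quat_k = quat_i" "quat_k * quat_i = quat_j"
  by (simp_all add: quat_eq_iff quat_i_def quat_j_def quat_k_def)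

subsection \<open>The Lie algebras and the reductive complement\<close>

(* Rows and columns are indexed by the type 2, whose elements are 1 and 2 (= 0). *)
type_synonym qmat = "quat^2^2"

definition qscale :: "quat \<Rightarrow> qmat \<Rightarrow> qmat" where
  "qscale q M = (\<chi> r c. q * M $ r $ c)"

definition matE :: "2 \<Rightarrow> 2 \<Rightarrow> qmat" where
  "matE i j = (\<chi> r c. if r = i \<and> c = j then - 1 else if r = j \<and> c = i then 1 else 0)"

definition matF :: "2 \<Rightarrow> 2 \<Rightarrow> qmat" where
  "matF i j = (\<chi> r c. if r = i \<and> c = j \<or> r = j \<and> c = i then 1 else 0)"

definition sp2 :: "qmat set" where
  "sp2 = {X. \<forall>r c. X $ c $ r = - quat_cnj (X $ r $ c)}"

definition bracket :: "qmat \<Rightarrow> qmat \<Rightarrow> qmat" where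
  "bracket X Y = X ** Y - Y ** X"

definition B0 :: "qmat \<Rightarrow> qmat \<Rightarrow> real" where
  "B0 X Y = - qre (trace (X ** Y))"

definition \<hh> :: "qmat set" where
  "\<hh> = span {qscale quat_i (matF 2 2), qscale quat_j (matF 2 2), qscale quat_k (matF 2 2)}"

definition \<mm> :: "qmat set" where
  "\<mm> = {X \<in> sp2. \<forall>Y\<in>\<hh>. B0 X Y = 0}"

definition \<mm>_part :: "nat \<Rightarrow> qmat set" where
  "\<mm>_part r =
    (if r = 1 then span {qscale quat_i (matF 1 1)}
     else if r = 2 then span {qscale quat_k (matF 1 1)}
     else if r = 3 then span {qscale quat_j (matF 1 1)}
     else span {qscale quat_i (matF 1 2), qscale quat_j (matF 1 2), qscale quat_k (matF 1 2),
                matE 1 2})"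

(* B0-orthogonal projection; B0 is positive definite on sp2, so for a subspace S of sp2 the
   vector exists and is unique. *)
definition B0_proj :: "qmat set \<Rightarrow> qmat \<Rightarrow> qmat" where
  "B0_proj S X = (THE Y. Y \<in> S \<and> (\<forall>Z\<in>S. B0 (X - Y) Z = 0))"

subsection \<open>The invariant metric and its Levi-Civita map\<close>

definition metric :: "(nat \<Rightarrow> real) \<Rightarrow> qmat \<Rightarrow> qmat \<Rightarrow> real" where
  "metric a X Y = (\<Sum>r=1..4. a r * B0 (B0_proj (\<mm>_part r) X) (B0_proj (\<mm>_part r) Y))"

definition frame :: "(nat \<Rightarrow> real) \<Rightarrow> nat \<Rightarrow> qmat" where
  "frame a n =
    (if n = 1 then (1 / sqrt (a 1)) *\<^sub>R qscale quat_i (matF 1 1)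
     else if n = 2 then - (1 / sqrt (a 2)) *\<^sub>R qscale quat_k (matF 1 1)
     else if n = 3 then (1 / sqrt (a 3)) *\<^sub>R qscale quat_j (matF 1 1)
     else if n = 4 then (1 / sqrt (2 * a 4)) *\<^sub>R qscale quat_j (matF 1 2)
     else if n = 5 then (1 / sqrt (2 * a 4)) *\<^sub>R qscale quat_k (matF 1 2)
     else if n = 6 then (1 / sqrt (2 * a 4)) *\<^sub>R qscale quat_i (matF 1 2)
     else (1 / sqrt (2 * a 4)) *\<^sub>R matE 1 2)"

definition U_map :: "(nat \<Rightarrow> real) \<Rightarrow> qmat \<Rightarrow> qmat \<Rightarrow> qmat" where
  "U_map a X Y = (THE U. U \<in> \<mm> \<and>
     (\<forall>Z\<in>\<mm>. 2 * metric a U Z =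
        metric a (B0_proj \<mm> (bracket Z X)) Y + metric a X (B0_proj \<mm> (bracket Z Y))))"

definition Lambda_map :: "(nat \<Rightarrow> real) \<Rightarrow> qmat \<Rightarrow> qmat \<Rightarrow> qmat" where
  "Lambda_map a X Y = (1/2) *\<^sub>R B0_proj \<mm> (bracket X Y) + U_map a X Y"

subsection \<open>Exterior algebra\<close>

(* The exterior algebra of the complex vector space with basis indexed by 'n: the coordinate at S
   is the coefficient of the wedge product of the generators in S, taken in increasing order.
   The choice of linear order on 'n only affects this encoding. *)
type_synonym 'n ext = "complex ^ ('n set)"

definition ext_one :: "('n::{finite,linorder}) ext" where
  "ext_one = axis {} 1"

definition gen :: "('n::{finite,linorder}) \<Rightarrow> 'n ext" where
  "gen j = axis {j} 1"

definition wedge :: "('n::{finite,linorder}) ext \<Rightarrow> 'n ext \<Rightarrow> 'n ext" (infixr \<open>\<and>\<^sub>e\<close> 70) where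
  "u \<and>\<^sub>e v = (\<chi> S. \<Sum>T\<in>Pow S.
      (- 1) ^ card {(p, q). p \<in> T \<and> q \<in> S - T \<and> q < p} * (u $ T * v $ (S - T)))"

definition grade_inv :: "('n::{finite,linorder}) ext \<Rightarrow> 'n ext" where
  "grade_inv u = (\<chi> S. (- 1) ^ card S * u $ S)"

(* The antiderivation dual to gen j; see contract_gen and contract_wedge. *)
definition contract :: "('n::{finite,linorder}) \<Rightarrow> 'n ext \<Rightarrow> 'n ext" where
  "contract j u = (\<chi> S. if j \<in> S then 0 else (- 1) ^ card {p \<in> S. p < j} * u $ (insert j S))"

lemma contract_gen: "contract j (gen k) = (if j = k then ext_one else 0)"
proof -
  have "j \<notin> S \<Longrightarrow> insert j S = {k} \<longleftrightarrow> S = {} \<and> j = k" for S by auto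
  then show ?thesis
    by (auto simp: vec_eq_iff contract_def gen_def ext_one_def axis_def)
qed

lemma inversions_insert_left:
  fixes j :: "'n::{finite,linorder}"
  assumes "j \<notin> T"
  shows "(- 1 :: complex) ^ card {(p, q). p \<in> insert j T \<and> q \<in> R \<and> q < p} =
         (- 1) ^ card {(p, q). p \<in> T \<and> q \<in> R \<and> q < p} * (- 1) ^ card {q \<in> R. q < j}"
proof -
  have "{(p, q). p \<in> insert j T \<and> q \<in> R \<and> q < p} =
        {(p, q). p \<in> T \<and> q \<in> R \<and> q < p} \<union> Pair j ` {q \<in> R. q < j}" by auto
  moreover have "{(p, q). p \<in> T \<and> q \<in> R \<and> q < p} \<inter> Pair j ` {q \<in> R. q < j} = {}"
    using assms by auto
  ultimately have "card {(p, q). p \<in> insert j T \<and> q \<in> R \<and> q < p} =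
      card {(p, q). p \<in> T \<and> q \<in> R \<and> q < p} + card {q \<in> R. q < j}"
    by (simp add: card_Un_disjoint card_image inj_on_def)
  then show ?thesis by (simp add: power_add)
qed

lemma inversions_insert_right:
  fixes j :: "'n::{finite,linorder}"
  assumes "j \<notin> R"
  shows "(- 1 :: complex) ^ card {(p, q). p \<in> T \<and> q \<in> insert j R \<and> q < p} =
         (- 1) ^ card {(p, q). p \<in> T \<and> q \<in> R \<and> q < p} * (- 1) ^ card {p \<in> T. j < p}"
proof -
  have "{(p, q). p \<in> T \<and> q \<in> insert j R \<and> q < p} =
        {(p, q). p \<in> T \<and> q \<in> R \<and> q < p} \<union> (\<lambda>p. (p, j)) ` {p \<in> T. j < p}" by auto
  moreover have "{(p, q). p \<in> T \<and> q \<in> R \<and> q < p} \<inter> (\<lambda>p. (p, j)) ` {p \<in> T. j < p} = {}"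
    using assms by auto
  ultimately have "card {(p, q). p \<in> T \<and> q \<in> insert j R \<and> q < p} =
      card {(p, q). p \<in> T \<and> q \<in> R \<and> q < p} + card {p \<in> T. j < p}"
    by (simp add: card_Un_disjoint card_image inj_on_def)
  then show ?thesis by (simp add: power_add)
qed

lemma sum_Pow_insert:
  fixes f :: "'n::finite set \<Rightarrow> complex"
  assumes "j \<notin> S"
  shows "sum f (Pow (insert j S)) = (\<Sum>T\<in>Pow S. f T + f (insert j T))"
proof -
  have "inj_on (insert j) (Pow S)" using assms by (auto simp: inj_on_def)
  moreover have "Pow S \<inter> insert j ` Pow S = {}" using assms by auto
  ultimately show ?thesis
    by (simp add: Pow_insert sum.union_disjoint sum.reindex sum.distrib)
qed

lemma card_split_at:
  fixes j :: "'n::{finite,linorder}"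
  assumes "j \<notin> T"
  shows "card T = card {p \<in> T. p < j} + card {p \<in> T. j < p}"
proof -
  have "T = {p \<in> T. p < j} \<union> {p \<in> T. j < p}"
    using assms by (auto simp: neq_iff) (metis neq_iff)
  then have "card T = card ({p \<in> T. p < j} \<union> {p \<in> T. j < p})" by simp
  also have "\<dots> = card {p \<in> T. p < j} + card {p \<in> T. j < p}"
    by (rule card_Un_disjoint) auto
  finally show ?thesis .
qed

lemma contract_wedge:
  "contract j (u \<and>\<^sub>e v) = contract j u \<and>\<^sub>e v + grade_inv u \<and>\<^sub>e contract j v"
proof (rule vec_eq_iff[THEN iffD2], rule allI)
  fix S
  let ?sg = "\<lambda>T R. (- 1 :: complex) ^ card {(p, q). p \<in> T \<and> q \<in> R \<and> q < p}"
  let ?lt = "\<lambda>T. (- 1 :: complex) ^ card {p \<in> T. p < j}"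
  let ?gt = "\<lambda>T. (- 1 :: complex) ^ card {p \<in> T. j < p}"
  let ?f = "\<lambda>S T. ?sg T (S - T) * (u $ T * v $ (S - T))"
  let ?g = "\<lambda>S T. ?sg T (S - T) * (contract j u $ T * v $ (S - T))
                + ?sg T (S - T) * (grade_inv u $ T * contract j v $ (S - T))"
  have sq: "?lt T * ?lt T = 1" "?gt T * ?gt T = 1" for T
    by (simp_all flip: power_add)
  have cancel1: "A * B * (N * C * (p * q) + N * B * (r * t)) = N * (A * r * t) + N * (A * C * p * (B * q))"
    if "B * B = 1" for A B C N p q r t :: complex
    using that by algebra
  have cancel2: "N * C * (A * p * q) + N * B * (- (A * C) * p * (B * q)) = 0"
    if "B * B = 1" for A B C N p q :: complex
    using that by algebra
  have rhs: "(contract j u \<and>\<^sub>e v + grade_inv u \<and>\<^sub>e contract j v) $ S = (\<Sum>T\<in>Pow S. ?g S T)"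
    by (simp add: wedge_def sum.distrib)
  show "contract j (u \<and>\<^sub>e v) $ S = (contract j u \<and>\<^sub>e v + grade_inv u \<and>\<^sub>e contract j v) $ S"
  proof (cases "j \<in> S")
    case False
    have "?lt S * (?f (insert j S) T + ?f (insert j S) (insert j T)) = ?g S T" if "T \<in> Pow S" for T
    proof -
      have T: "T \<subseteq> S" "j \<notin> T" "j \<notin> S - T" using that False by auto
      have e: "insert j S - insert j T = S - T" "insert j S - T = insert j (S - T)"
        using T False by auto
      have "card {p \<in> S. p < j} = card {p \<in> T. p < j} + card {p \<in> S - T. p < j}"
        by (subst card_Un_disjoint[symmetric]) (use T in \<open>auto intro: arg_cong[where f = card]\<close>)
      then have l: "?lt S = ?lt T * ?lt (S - T)" by (simp only: power_add)
      have r: "(- 1 :: complex) ^ card T = ?lt T * ?gt T"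
        by (simp only: card_split_at[OF T(2)] power_add)
      have g: "?g S T = ?sg T (S - T) * (?lt T * u $ insert j T * v $ (S - T)) +
          ?sg T (S - T) * ((?lt T * ?gt T * u $ T) * (?lt (S - T) * v $ insert j (S - T)))"
        using T by (simp add: contract_def grade_inv_def r)
      show ?thesis
        unfolding g e l inversions_insert_left[OF T(2)] inversions_insert_right[OF T(3)]
        by (rule cancel1[OF sq(1)])
    qed
    note step = this
    have "contract j (u \<and>\<^sub>e v) $ S = ?lt S * (u \<and>\<^sub>e v) $ insert j S"
      using False by (simp add: contract_def)
    also have "(u \<and>\<^sub>e v) $ insert j S = (\<Sum>T\<in>Pow (insert j S). ?f (insert j S) T)"
      by (simp add: wedge_def)
    also have "\<dots> = (\<Sum>T\<in>Pow S. ?f (insert j S) T + ?f (insert j S) (insert j T))"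
      by (rule sum_Pow_insert[OF False])
    also have "?lt S * \<dots> = (\<Sum>T\<in>Pow S. ?g S T)"
      unfolding sum_distrib_left by (rule sum.cong[OF refl step])
    finally show ?thesis unfolding rhs .
  next
    case True
    then obtain S' where S: "S = insert j S'" "j \<notin> S'" by (meson Set.set_insert)
    have "?g S T + ?g S (insert j T) = 0" if "T \<in> Pow S'" for T
    proof -
      have T: "T \<subseteq> S'" "j \<notin> T" "j \<notin> S' - T" using that S by auto
      have e: "S - insert j T = S' - T" "S - T = insert j (S' - T)"
        using T S by auto
      have r: "(- 1 :: complex) ^ card (insert j T) = - (?lt T * ?gt T)"
        using T by (simp add: card_split_at[OF T(2)] power_add)
      have c: "contract j u $ T = ?lt T * u $ insert j T"
        "contract j v $ insert j (S' - T) = 0" "contract j u $ insert j T = 0"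
        "contract j v $ (S' - T) = ?lt (S' - T) * v $ insert j (S' - T)"
        "grade_inv u $ insert j T = - (?lt T * ?gt T) * u $ insert j T"
        using T by (simp_all add: contract_def grade_inv_def r del: power_Suc card_insert_disjoint)
      show ?thesis
        unfolding e inversions_insert_left[OF T(2)] inversions_insert_right[OF T(3)] c
          mult_zero_left mult_zero_right add_0_left add_0_right
        by (rule cancel2[OF sq(1)])
    qed
    then have "(\<Sum>T\<in>Pow S. ?g S T) = 0"
      unfolding S(1) sum_Pow_insert[OF S(2)] by (intro sum.neutral) simp
    then show ?thesis
      using True unfolding rhs by (simp add: contract_def)
  qed
qed

subsection \<open>The spin module\<close>

type_synonym spinor = "3 ext"

(* The elements of the type 3 are 1, 2 and 3 (= 0). *)
abbreviation y_gen :: "3 \<Rightarrow> spinor" where "y_gen \<equiv> gen"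

definition cliff_e :: "nat \<Rightarrow> spinor \<Rightarrow> spinor" where
  "cliff_e n \<eta> =
    (if n = 1 then \<i> *s grade_inv \<eta>
     else let j = of_nat (n div 2) in
       if even n then \<i> *s (contract j \<eta> + y_gen j \<and>\<^sub>e \<eta>)
       else y_gen j \<and>\<^sub>e \<eta> - contract j \<eta>)"

definition cliff :: "(nat \<Rightarrow> real) \<Rightarrow> qmat \<Rightarrow> spinor \<Rightarrow> spinor" where
  "cliff a X \<eta> = (\<Sum>n=1..7. metric a X (frame a n) *\<^sub>R cliff_e n \<eta>)"

(* A skew endomorphism T of \<mm> equals the sum over m < n of g(T e_m, e_n) e_m \<and> e_n. *)
definition spin_lift :: "(nat \<Rightarrow> real) \<Rightarrow> (qmat \<Rightarrow> qmat) \<Rightarrow> spinor \<Rightarrow> spinor" where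
  "spin_lift a T \<eta> = (\<Sum>n=1..7. \<Sum>m=1..<n.
      (metric a (T (frame a m)) (frame a n) / 2) *\<^sub>R cliff_e m (cliff_e n \<eta>))"

definition invariant_spinor :: "(nat \<Rightarrow> real) \<Rightarrow> spinor \<Rightarrow> bool" where
  "invariant_spinor a \<psi> \<longleftrightarrow> (\<forall>H\<in>\<hh>. spin_lift a (bracket H) \<psi> = 0)"

(* The Levi-Civita covariant derivative, at the origin, of the invariant spinor field given by
   the constant equivariant map with value \<psi>. *)
definition nabla :: "(nat \<Rightarrow> real) \<Rightarrow> qmat \<Rightarrow> spinor \<Rightarrow> spinor" where
  "nabla a X \<psi> = spin_lift a (Lambda_map a X) \<psi>"

definition symmetric_endo :: "(nat \<Rightarrow> real) \<Rightarrow> (qmat \<Rightarrow> qmat) \<Rightarrow> bool" where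
  "symmetric_endo a A \<longleftrightarrow>
    (\<forall>X\<in>\<mm>. A X \<in> \<mm>) \<and>
    (\<forall>X\<in>\<mm>. \<forall>Y\<in>\<mm>. A (X + Y) = A X + A Y) \<and>
    (\<forall>c. \<forall>X\<in>\<mm>. A (c *\<^sub>R X) = c *\<^sub>R A X) \<and>
    (\<forall>X\<in>\<mm>. \<forall>Y\<in>\<mm>. metric a (A X) Y = metric a X (A Y))"

definition generalized_killing_with ::
    "(nat \<Rightarrow> real) \<Rightarrow> (qmat \<Rightarrow> qmat) \<Rightarrow> spinor \<Rightarrow> bool" where
  "generalized_killing_with a A \<psi> \<longleftrightarrow>
    invariant_spinor a \<psi> \<and> symmetric_endo a A \<and> (\<forall>X\<in>\<mm>. nabla a X \<psi> = cliff a (A X) \<psi>)"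

subsection \<open>The spinors and the eigenvalues\<close>

definition \<omega> :: spinor where "\<omega> = y_gen 2 \<and>\<^sub>e y_gen 3"

definition psi :: "nat \<Rightarrow> spinor" where
  "psi k = complex_of_real (1 / sqrt 2) *s
    (if k = 0 then \<omega> + \<i> *s y_gen 1
     else if k = 1 then \<i> *s \<omega> + y_gen 1
     else if k = 2 then - ext_one + \<i> *s (y_gen 1 \<and>\<^sub>e \<omega>)
     else - (\<i> *s ext_one) + y_gen 1 \<and>\<^sub>e \<omega>)"

definition b_coeff :: "(nat \<Rightarrow> real) \<Rightarrow> nat \<Rightarrow> real" where
  "b_coeff a r = (if r = 4 then 2 * a 4 else a r)"

definition Theta :: "(nat \<Rightarrow> real) \<Rightarrow> nat \<Rightarrow> nat \<Rightarrow> nat \<Rightarrow> real" where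
  "Theta a l m n = sqrt (b_coeff a l / (b_coeff a m * b_coeff a n))"

(* The representative in {1, 2, 3} of n modulo 3, for n \<ge> 1. *)
definition cyc :: "nat \<Rightarrow> nat" where
  "cyc n = (n - 1) mod 3 + 1"

definition lam :: "(nat \<Rightarrow> real) \<Rightarrow> nat \<Rightarrow> nat \<Rightarrow> real" where
  "lam a k p =
    (if p \<in> {1, 2, 3} then
       (let c = 1/2 * (- Theta a p (cyc (p + 1)) (cyc (p + 2))
                       + Theta a (cyc (p + 1)) p (cyc (p + 2))
                       + Theta a (cyc (p + 2)) p (cyc (p + 1)));
            d = Theta a 4 p 4 - Theta a p 4 4
        in if k = 0 \<or> k = p then c - d else c + d)
     else if k = 0 then - (1/2) * (Theta a 1 4 4 + Theta a 2 4 4 + Theta a 3 4 4)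
     else 1/2 * (- Theta a k 4 4 + Theta a (cyc (k + 1)) 4 4 + Theta a (cyc (k + 2)) 4 4))"

definition A_endo :: "(nat \<Rightarrow> real) \<Rightarrow> nat \<Rightarrow> qmat \<Rightarrow> qmat" where
  "A_endo a k X = (\<Sum>p=1..4. lam a k p *\<^sub>R B0_proj (\<mm>_part p) X)"

end

theory Submission
  imports Defs
begin

text \<open>In the frame \<open>e\<^sub>1, \<dots>, e\<^sub>7\<close> everything is governed by the numbers
  \<open>T(i,m,n) = B\<^sub>0([e\<^sub>i,e\<^sub>m],e\<^sub>n)\<close>, which are totally antisymmetric because \<open>B\<^sub>0\<close> is
  \<open>ad\<close>-invariant. As \<open>g\<close> is a multiple of \<open>B\<^sub>0\<close> along each \<open>e\<^sub>n\<close>, the Koszul formula collapses to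
  \<open>g(\<Lambda>(e\<^sub>i)e\<^sub>m, e\<^sub>n) = (a\<^sub>m + a\<^sub>n - a\<^sub>i)/2 \<cdot> T(i,m,n)\<close> (\<open>Lambda_map_frame\<close>), where \<open>a\<^sub>n\<close> is the
  parameter of the summand that contains \<open>e\<^sub>n\<close>.

  The triples with \<open>T(i,m,n) \<noteq> 0\<close> are the seven lines of a Fano plane: \<open>{1,2,3}\<close>, and for each
  \<open>p \<in> {1,2,3}\<close> two lines that join \<open>p\<close> to a pair from \<open>{4,5,6,7}\<close>. For such a line
  \<open>e\<^sub>i e\<^sub>m e\<^sub>n\<close> squares to \<open>1\<close> in the Clifford algebra, and since two lines meet in exactly one point
  these seven products commute. The four spinors are joint eigenvectors of them: if \<open>(i,m,n)\<close>
  is ordered so that \<open>T(i,m,n) > 0\<close>, then \<open>e\<^sub>m e\<^sub>n \<psi> = \<sigma> e\<^sub>i \<psi>\<close> with a sign \<open>\<sigma>\<close> that is \<open>1\<close> on \<open>{1,2,3}\<close>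
  and is the same on both lines from \<open>p\<close> to \<open>{4,5,6,7}\<close> (\<open>fano_lines\<close>).

  Both claims about \<open>\<psi>\<close> follow from these eigenvalue equations. An element of \<open>\<hh>\<close> acts on the span of
  \<open>e\<^sub>4, \<dots>, e\<^sub>7\<close> by a combination of three 2-forms, one for each \<open>p\<close>; each is a difference of
  the two pairs completing \<open>p\<close> to a line, ordered as before, and the two terms cancel on \<open>\<psi>\<close> because they have the
  same sign \<open>\<sigma>\<close> (\<open>invariant_psi\<close>). In \<open>\<nabla>\<close> along \<open>e\<^sub>i\<close> only the three lines through
  \<open>i\<close> contribute, each a multiple of \<open>e\<^sub>i \<psi>\<close>; hence \<open>\<nabla>\<close> along \<open>e\<^sub>i\<close> is Clifford multiplication by
  \<open>\<lambda> e\<^sub>i\<close>, and adding the three coefficients gives the stated eigenvalue (\<open>nabla_frame_psi\<close>). Both sides are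
  linear in the direction, so this extends from the frame to \<open>\<mm>\<close>.\<close>

(* Keeps the index 1 a numeral, so that it matches the equations for the frame. *)
declare One_nat_def [simp del]

section \<open>The invariant form and the bracket\<close>

lemma qre_trace_commute: "qre (trace (X ** Y)) = qre (trace (Y ** (X::qmat)))"
  unfolding trace_def matrix_matrix_mult_def by (simp add: sum_2)

lemma B0_commute: "B0 X Y = B0 Y X"
  unfolding B0_def by (simp add: qre_trace_commute)

lemma B0_add_left: "B0 (X + Y) Z = B0 X Z + B0 Y Z"
  and B0_scale_left: "B0 (c *\<^sub>R X) Z = c * B0 X Z"
  and B0_diff_left: "B0 (X - Y) Z = B0 X Z - B0 Y Z"
  unfolding B0_def trace_def matrix_matrix_mult_def by (simp_all add: sum_2 algebra_simps)

lemma B0_scale_right: "B0 Z (c *\<^sub>R X) = c * B0 Z X"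
  using B0_scale_left[of c X Z] by (simp add: B0_commute)

lemma linear_B0: "linear (\<lambda>X. B0 X Z)"
  by (rule linearI) (simp_all add: B0_add_left B0_scale_left)

lemma B0_sum_left: "B0 (\<Sum>n\<in>I. c n *\<^sub>R v n) Z = (\<Sum>n\<in>I. c n * B0 (v n) Z)"
  using linear_sum[OF linear_B0[of Z], of "\<lambda>n. c n *\<^sub>R v n" I] by (simp add: B0_scale_left)

lemma matrix_minus_left: "(A - B) ** C = A ** C - B ** (C::'a::ring_1^'n^'n)"
  and matrix_minus_right: "C ** (A - B) = C ** A - C ** (B::'a::ring_1^'n^'n)"
  by (simp_all add: vec_eq_iff matrix_matrix_mult_def left_diff_distrib right_diff_distrib sum_subtractf)

text \<open>Cyclicity of the real trace makes \<open>B0 (bracket X Y) Z\<close> invariant under cyclic permutations; with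
  antisymmetry of the bracket it is an alternating 3-form.\<close>

lemma B0_bracket: "B0 (bracket X Y) Z = B0 X (bracket Y Z)"
proof -
  have "qre (trace (Y ** X ** Z)) = qre (trace (X ** Z ** Y))"
    using qre_trace_commute[of Y "X ** Z"] by (simp add: matrix_mul_assoc)
  then show ?thesis
    unfolding B0_def bracket_def
    by (simp add: matrix_minus_left matrix_minus_right matrix_mul_assoc trace_def sum_subtractf)
qed

lemma bracket_commute: "bracket X Y = (-1) *\<^sub>R bracket Y X"
  by (simp add: bracket_def)

lemma linear_bracket_left: "linear (\<lambda>X. bracket X Y)"
  by (rule linearI)
    (simp_all add: bracket_def vec_eq_iff matrix_matrix_mult_def distrib_left distrib_right
      sum.distrib scaleR_sum_right scaleR_diff_right)

lemma linear_bracket_right: "linear (bracket X)"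
  by (rule linearI)
    (simp_all add: bracket_def vec_eq_iff matrix_matrix_mult_def distrib_left distrib_right
      sum.distrib scaleR_sum_right scaleR_diff_right)

section \<open>Orthogonal projections\<close>

lemma orthogonal_expansion:
  assumes "finite I" and orth: "\<And>m n. m \<in> I \<Longrightarrow> n \<in> I \<Longrightarrow> m \<noteq> n \<Longrightarrow> B0 (v m) (v n) = 0"
    and pos: "\<And>n. n \<in> I \<Longrightarrow> B0 (v n) (v n) > 0"
    and "X \<in> span (v ` I)"
  shows "X = (\<Sum>n\<in>I. (B0 X (v n) / B0 (v n) (v n)) *\<^sub>R v n)"
  using assms(4)
proof (induction rule: span_induct)
  case base
  show ?case
  proof (rule subspaceI; clarify)
    fix X Y
    assume "X = (\<Sum>n\<in>I. (B0 X (v n) / B0 (v n) (v n)) *\<^sub>R v n)"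
      and "Y = (\<Sum>n\<in>I. (B0 Y (v n) / B0 (v n) (v n)) *\<^sub>R v n)"
    then show "X + Y = (\<Sum>n\<in>I. (B0 (X + Y) (v n) / B0 (v n) (v n)) *\<^sub>R v n)"
      by (simp add: B0_add_left add_divide_distrib scaleR_add_left sum.distrib)
  next
    fix c X
    assume "X = (\<Sum>n\<in>I. (B0 X (v n) / B0 (v n) (v n)) *\<^sub>R v n)"
    then have "c *\<^sub>R X = c *\<^sub>R (\<Sum>n\<in>I. (B0 X (v n) / B0 (v n) (v n)) *\<^sub>R v n)" by simp
    also have "\<dots> = (\<Sum>n\<in>I. (B0 (c *\<^sub>R X) (v n) / B0 (v n) (v n)) *\<^sub>R v n)"
      by (simp add: B0_scale_left scaleR_sum_right)
    finally show "c *\<^sub>R X = (\<Sum>n\<in>I. (B0 (c *\<^sub>R X) (v n) / B0 (v n) (v n)) *\<^sub>R v n)" .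
  qed (simp add: linear_0[OF linear_B0])
next
  case (step x)
  then obtain m where m: "m \<in> I" "x = v m" by blast
  have "(B0 x (v n) / B0 (v n) (v n)) *\<^sub>R v n = (if n = m then v m else 0)" if "n \<in> I" for n
    using that m orth pos[of m] by auto
  then show ?case using m \<open>finite I\<close> by simp
qed

text \<open>The form \<open>B0\<close> is indefinite on all quaternionic matrices, but positivity on an orthogonal spanning
  family already makes the defining vector of \<open>B0_proj\<close> exist and be unique, for every
  \<open>X\<close>.\<close>

lemma B0_proj_span:
  assumes "finite I" and orth: "\<And>m n. m \<in> I \<Longrightarrow> n \<in> I \<Longrightarrow> m \<noteq> n \<Longrightarrow> B0 (v m) (v n) = 0"
    and pos: "\<And>n. n \<in> I \<Longrightarrow> B0 (v n) (v n) > 0"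
  shows "B0_proj (span (v ` I)) X = (\<Sum>n\<in>I. (B0 X (v n) / B0 (v n) (v n)) *\<^sub>R v n)"
    (is "_ = ?P")
  unfolding B0_proj_def
proof (rule the_equality)
  have "B0 ?P (v m) = B0 X (v m)" if "m \<in> I" for m
  proof -
    have "B0 ?P (v m) = (\<Sum>n\<in>I. if n = m then B0 X (v m) else 0)"
      unfolding B0_sum_left using orth that pos[OF that] by (intro sum.cong) auto
    then show ?thesis using that \<open>finite I\<close> by simp
  qed
  then have "B0 (v m) (X - ?P) = 0" if "m \<in> I" for m
    using that by (simp add: B0_diff_left B0_commute[of "v m"])
  then have perp: "B0 Z (X - ?P) = 0" if "Z \<in> span (v ` I)" for Z
    using that linear_eq_on_span[OF linear_B0 module_hom_zero, of "v ` I" "X - ?P"] by auto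
  show P: "?P \<in> span (v ` I) \<and> (\<forall>Z\<in>span (v ` I). B0 (X - ?P) Z = 0)"
    using perp by (simp add: B0_commute[of "X - ?P"] span_sum span_scale span_base)
  fix Y assume Y: "Y \<in> span (v ` I) \<and> (\<forall>Z\<in>span (v ` I). B0 (X - Y) Z = 0)"
  have "B0 (Y - ?P) (v n) = 0" if "n \<in> I" for n
  proof -
    have "v n \<in> span (v ` I)" using that by (simp add: span_base)
    then have "B0 (X - Y) (v n) = 0" "B0 (X - ?P) (v n) = 0" using Y P by blast+
    then show ?thesis by (simp add: B0_diff_left)
  qed
  moreover have "Y - ?P \<in> span (v ` I)" using P Y span_diff by blast
  ultimately have "Y - ?P = 0"
    using orthogonal_expansion[where X = "Y - ?P" and v = v, OF assms] by simp
  then show "Y = ?P" by simp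
qed

section \<open>A basis of the reductive complement\<close>

text \<open>The frame before normalization. It is \<open>B0\<close>-orthogonal, its brackets have integer coordinates, and
  it does not depend on the metric.\<close>

definition mbasis :: "nat \<Rightarrow> qmat" where
  "mbasis n =
    (if n = 1 then qscale quat_i (matF 1 1)
     else if n = 2 then - qscale quat_k (matF 1 1)
     else if n = 3 then qscale quat_j (matF 1 1)
     else if n = 4 then qscale quat_j (matF 1 2)
     else if n = 5 then qscale quat_k (matF 1 2)
     else if n = 6 then qscale quat_i (matF 1 2)
     else matE 1 2)"

text \<open>The summand \<open>\<mm>_part (block n)\<close> is the one that contains \<open>mbasis n\<close>.\<close>

definition block :: "nat \<Rightarrow> nat" where "block n = (if n \<le> 3 then n else 4)"

definition sqnorm :: "nat \<Rightarrow> real" where "sqnorm n = (if n \<le> 3 then 1 else 2)"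

lemma frame_mbasis: "frame a n = (1 / sqrt (a (block n) * sqnorm n)) *\<^sub>R mbasis n"
  if "n \<in> {1..7}"
  using that by (auto simp: frame_def mbasis_def block_def sqnorm_def mult.commute)

lemma mbasis_entries:
  "mbasis n $ 1 $ 1 = (if n = 1 then quat_i else if n = 2 then - quat_k
     else if n = 3 then quat_j else 0)"
  "mbasis n $ 1 $ 2 = (if n \<le> 3 \<and> n \<noteq> 0 then 0 else if n = 4 then quat_j
     else if n = 5 then quat_k else if n = 6 then quat_i else - 1)"
  "mbasis n $ 2 $ 1 = (if n \<le> 3 \<and> n \<noteq> 0 then 0 else if n = 4 then quat_j
     else if n = 5 then quat_k else if n = 6 then quat_i else 1)"
  "mbasis n $ 2 $ 2 = 0"
  by (auto simp: mbasis_def qscale_def matF_def matE_def)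

lemma quat_unit_sel [simp]:
  "qre quat_i = 0" "qi quat_i = 1" "qj quat_i = 0" "qk quat_i = 0"
  "qre quat_j = 0" "qi quat_j = 0" "qj quat_j = 1" "qk quat_j = 0"
  "qre quat_k = 0" "qi quat_k = 0" "qj quat_k = 0" "qk quat_k = 1"
  by (simp_all add: quat_i_def quat_j_def quat_k_def)

lemma B0_entries:
  "B0 X Y = - qre (X $ 1 $ 1 * Y $ 1 $ 1 + X $ 1 $ 2 * Y $ 2 $ 1 + X $ 2 $ 1 * Y $ 1 $ 2
     + X $ 2 $ 2 * Y $ 2 $ 2)"
  unfolding B0_def trace_def matrix_matrix_mult_def by (simp add: sum_2)

lemma B0_mbasis:
  "B0 X (mbasis n) =
    (if n = 1 then qi (X $ 1 $ 1) else if n = 2 then - qk (X $ 1 $ 1) else if n = 3 then qj (X $ 1 $ 1)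
     else if n = 4 then qj (X $ 1 $ 2) + qj (X $ 2 $ 1)
     else if n = 5 then qk (X $ 1 $ 2) + qk (X $ 2 $ 1)
     else if n = 6 then qi (X $ 1 $ 2) + qi (X $ 2 $ 1)
     else qre (X $ 2 $ 1) - qre (X $ 1 $ 2))"
  unfolding B0_entries by (simp add: mbasis_entries)

lemma atLeastAtMost_1_7: "{1..7} = {1, 2, 3, 4, 5, 6, 7::nat}" by auto

lemma B0_mbasis_mbasis:
  assumes "m \<in> {1..7}" "n \<in> {1..7}"
  shows "B0 (mbasis m) (mbasis n) = (if m = n then sqnorm n else 0)"
  using assms unfolding atLeastAtMost_1_7
  by (elim insertE emptyE) (simp_all add: B0_mbasis mbasis_entries sqnorm_def)

lemma sqnorm_pos: "sqnorm n > 0" by (simp add: sqnorm_def)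

lemma B0_proj_mbasis:
  assumes "I \<subseteq> {1..7}"
  shows "B0_proj (span (mbasis ` I)) X = (\<Sum>n\<in>I. (B0 X (mbasis n) / sqnorm n) *\<^sub>R mbasis n)"
proof -
  have "B0 (mbasis m) (mbasis n) = (if m = n then sqnorm n else 0)" if "m \<in> I" "n \<in> I" for m n
    using that assms B0_mbasis_mbasis by blast
  moreover have "finite I" using assms finite_subset by blast
  ultimately show ?thesis by (subst B0_proj_span) (auto simp: sqnorm_pos)
qed

lemma \<hh>_entries:
  assumes "H \<in> \<hh>"
  shows "H $ 1 $ 1 = 0" "H $ 1 $ 2 = 0" "H $ 2 $ 1 = 0" "qre (H $ 2 $ 2) = 0"
proof -
  have "H $ 1 $ 1 = 0 \<and> H $ 1 $ 2 = 0 \<and> H $ 2 $ 1 = 0 \<and> qre (H $ 2 $ 2) = 0"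
    using assms unfolding \<hh>_def
  proof (induction rule: span_induct)
    case base
    show ?case by (rule subspaceI) auto
  next
    case (step x)
    then show ?case by (auto simp: qscale_def matF_def)
  qed
  then show "H $ 1 $ 1 = 0" "H $ 1 $ 2 = 0" "H $ 2 $ 1 = 0" "qre (H $ 2 $ 2) = 0" by auto
qed

lemma \<mm>_entries:
  "X \<in> \<mm> \<longleftrightarrow> qre (X $ 1 $ 1) = 0 \<and> X $ 2 $ 1 = - quat_cnj (X $ 1 $ 2) \<and> X $ 2 $ 2 = 0"
proof
  assume X: "X \<in> \<mm>"
  have skew: "X $ c $ r = - quat_cnj (X $ r $ c)" for r c
    using X unfolding \<mm>_def sp2_def by blast
  have "qscale q (matF 2 2) \<in> \<hh>" if "q \<in> {quat_i, quat_j, quat_k}" for q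
    unfolding \<hh>_def using that by (intro span_base) blast
  moreover have "\<forall>Y\<in>\<hh>. B0 X Y = 0" using X unfolding \<mm>_def by blast
  ultimately have "B0 X (qscale quat_i (matF 2 2)) = 0" "B0 X (qscale quat_j (matF 2 2)) = 0"
    "B0 X (qscale quat_k (matF 2 2)) = 0"
    by blast+
  then have "qi (X $ 2 $ 2) = 0" "qj (X $ 2 $ 2) = 0" "qk (X $ 2 $ 2) = 0"
    by (simp_all add: B0_entries qscale_def matF_def)
  moreover have "qre (X $ r $ r) = 0" for r :: 2
    using arg_cong[OF skew[of r r], of qre] by (simp add: quat_cnj_def)
  moreover note skew[of 2 1]
  ultimately show "qre (X $ 1 $ 1) = 0 \<and> X $ 2 $ 1 = - quat_cnj (X $ 1 $ 2) \<and> X $ 2 $ 2 = 0"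
    by (simp add: quat_eq_iff)
next
  assume X: "qre (X $ 1 $ 1) = 0 \<and> X $ 2 $ 1 = - quat_cnj (X $ 1 $ 2) \<and> X $ 2 $ 2 = 0"
  have "X \<in> sp2"
    unfolding sp2_def using X by (simp add: forall_2 quat_eq_iff quat_cnj_def)
  moreover have "B0 X Y = 0" if "Y \<in> \<hh>" for Y
    using X \<hh>_entries[OF that] by (simp add: B0_entries)
  ultimately show "X \<in> \<mm>" by (simp add: \<mm>_def)
qed

lemma \<mm>_eq_span: "\<mm> = span (mbasis ` {1..7})"
proof
  show "\<mm> \<subseteq> span (mbasis ` {1..7})"
  proof
    fix X assume "X \<in> \<mm>"
    then have "X = (\<Sum>n=1..7. (B0 X (mbasis n) / sqnorm n) *\<^sub>R mbasis n)"
      unfolding \<mm>_entries atLeastAtMost_1_7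
      by (simp add: vec_eq_iff forall_2 quat_eq_iff B0_mbasis mbasis_entries sqnorm_def quat_cnj_def)
    also have "\<dots> \<in> span (mbasis ` {1..7})"
      by (intro span_sum span_scale span_base imageI)
    finally show "X \<in> span (mbasis ` {1..7})" .
  qed
  have "mbasis n \<in> \<mm>" for n
    by (simp add: \<mm>_entries mbasis_entries quat_cnj_def quat_eq_iff)
  moreover have "subspace \<mm>"
    by (rule subspaceI) (auto simp: \<mm>_entries quat_cnj_def quat_eq_iff algebra_simps)
  ultimately show "span (mbasis ` {1..7}) \<subseteq> \<mm>"
    by (intro span_minimal) auto
qed

lemma \<mm>_part_eq_span:
  assumes "r \<in> {1..4}"
  shows "\<mm>_part r = span (mbasis ` {n \<in> {1..7}. block n = r})"
proof -
  have "r = 1 \<or> r = 2 \<or> r = 3 \<or> r = 4" using assms by auto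
  then show ?thesis
  proof (elim disjE)
    assume r: "r = 2"
    have "{n \<in> {1..7}. block n = r} = {2}" using r by (auto simp: block_def)
    moreover have "span {- x} = span {x}" for x :: qmat
      using span_neg[OF span_base, of x "{x}"] span_neg[OF span_base, of "- x" "{- x}"]
      by (intro subset_antisym span_minimal) simp_all
    ultimately show ?thesis by (simp add: \<mm>_part_def mbasis_def r)
  next
    assume r: "r = 4"
    have "{n \<in> {1..7}. block n = r} = {4,5,6,7}" using r by (auto simp: block_def)
    then show ?thesis by (simp add: \<mm>_part_def mbasis_def r insert_commute)
  next
    assume r: "r = 1"
    have "{n \<in> {1..7}. block n = r} = {1}" using r by (auto simp: block_def)
    then show ?thesis by (simp add: \<mm>_part_def mbasis_def r)
  next
    assume r: "r = 3"
    have "{n \<in> {1..7}. block n = r} = {3}" using r by (auto simp: block_def)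
    then show ?thesis by (simp add: \<mm>_part_def mbasis_def r)
  qed
qed

section \<open>The metric in the frame\<close>

lemma B0_proj_\<mm>: "B0_proj \<mm> X = (\<Sum>n=1..7. (B0 X (mbasis n) / sqnorm n) *\<^sub>R mbasis n)"
  unfolding \<mm>_eq_span by (rule B0_proj_mbasis) simp

lemma B0_proj_\<mm>_part:
  assumes "r \<in> {1..4}"
  shows "B0_proj (\<mm>_part r) X =
    (\<Sum>n | n \<in> {1..7} \<and> block n = r. (B0 X (mbasis n) / sqnorm n) *\<^sub>R mbasis n)"
  unfolding \<mm>_part_eq_span[OF assms] by (rule B0_proj_mbasis) blast

lemma B0_expansion_mbasis:
  assumes "I \<subseteq> {1..7}" "m \<in> {1..7}"
  shows "B0 (\<Sum>n\<in>I. (B0 X (mbasis n) / sqnorm n) *\<^sub>R mbasis n) (mbasis m) =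
    (if m \<in> I then B0 X (mbasis m) else 0)"
proof -
  have fin: "finite I" using assms(1) finite_subset by blast
  have "B0 (\<Sum>n\<in>I. (B0 X (mbasis n) / sqnorm n) *\<^sub>R mbasis n) (mbasis m) =
      (\<Sum>n\<in>I. if n = m then B0 X (mbasis m) else 0)"
    unfolding B0_sum_left
    by (rule sum.cong) (use assms sqnorm_pos[of m] in \<open>auto simp: B0_mbasis_mbasis subset_iff\<close>)
  then show ?thesis using fin by simp
qed

lemma sum_over_blocks: "(\<Sum>r=1..4. \<Sum>n | n \<in> {1..7} \<and> block n = r. f n) = (\<Sum>n=1..7. f n)"
  by (rule sum.group) (auto simp: block_def)

lemma metric_eq:
  "metric a X Y = (\<Sum>n=1..7. a (block n) * B0 X (mbasis n) * B0 Y (mbasis n) / sqnorm n)"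
proof -
  have "a r * B0 (B0_proj (\<mm>_part r) X) (B0_proj (\<mm>_part r) Y) =
      (\<Sum>n | n \<in> {1..7} \<and> block n = r. a (block n) * B0 X (mbasis n) * B0 Y (mbasis n) / sqnorm n)"
    if r: "r \<in> {1..4}" for r
  proof -
    have "B0 (mbasis n) (B0_proj (\<mm>_part r) Y) = B0 Y (mbasis n)"
      if "n \<in> {1..7} \<and> block n = r" for n
      using that unfolding B0_commute[of "mbasis n"] B0_proj_\<mm>_part[OF r]
      by (subst B0_expansion_mbasis) auto
    then show ?thesis
      by (subst B0_proj_\<mm>_part[OF r]) (auto simp: B0_sum_left sum_distrib_left intro!: sum.cong)
  qed
  then have "metric a X Y = (\<Sum>r=1..4. \<Sum>n | n \<in> {1..7} \<and> block n = r.
      a (block n) * B0 X (mbasis n) * B0 Y (mbasis n) / sqnorm n)"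
    unfolding metric_def by (intro sum.cong) auto
  then show ?thesis by (simp only: sum_over_blocks)
qed

lemma metric_commute: "metric a X Y = metric a Y X"
  unfolding metric_eq by (simp add: mult_ac)

lemma linear_metric_left: "linear (\<lambda>X. metric a X Y)"
  by (rule linearI) (simp_all add: metric_eq B0_add_left B0_scale_left distrib_left distrib_right
      add_divide_distrib sum.distrib sum_distrib_left mult_ac)

lemma linear_metric_right: "linear (metric a X)"
  unfolding metric_commute[of a X] by (rule linear_metric_left)

text \<open>The projection to \<open>\<mm>\<close> in the definitions of \<open>U_map\<close> and \<open>Lambda_map\<close> can be dropped inside the
  metric, which sees its arguments only through their \<open>B0\<close>-products with \<open>\<mm>\<close>.\<close>

lemma metric_proj_\<mm>: "metric a (B0_proj \<mm> X) Y = metric a X Y" "metric a Y (B0_proj \<mm> X) = metric a Y X"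
proof -
  have "B0 (B0_proj \<mm> X) (mbasis n) = B0 X (mbasis n)" if "n \<in> {1..7}" for n
    unfolding B0_proj_\<mm> using B0_expansion_mbasis[OF order_refl that] that by simp
  then show "metric a (B0_proj \<mm> X) Y = metric a X Y"
    unfolding metric_eq by (intro sum.cong) auto
  then show "metric a Y (B0_proj \<mm> X) = metric a Y X"
    by (simp add: metric_commute[of a Y])
qed

locale invariant_metric =
  fixes a :: "nat \<Rightarrow> real"
  assumes a_pos: "\<And>r. r \<in> {1..4} \<Longrightarrow> a r > 0"
begin

text \<open>The number \<open>b n\<close> is the squared length of \<open>mbasis n\<close> in the metric.\<close>

definition b :: "nat \<Rightarrow> real" where "b n = a (block n) * sqnorm n"

abbreviation "g \<equiv> metric a"
abbreviation "e \<equiv> frame a"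

lemma b_pos: "n \<in> {1..7} \<Longrightarrow> b n > 0"
  using a_pos[of "block n"] by (auto simp: b_def block_def sqnorm_def)

lemma frame_eq: "n \<in> {1..7} \<Longrightarrow> e n = (1 / sqrt (b n)) *\<^sub>R mbasis n"
  by (simp add: frame_mbasis b_def)

lemma metric_frame:
  assumes "n \<in> {1..7}"
  shows "g X (e n) = a (block n) * B0 X (e n)"
proof -
  have "g X (mbasis n) = (\<Sum>m=1..7. if m = n then a (block n) * B0 X (mbasis n) else 0)"
    unfolding metric_eq using assms sqnorm_pos[of n]
    by (intro sum.cong) (auto simp: B0_mbasis_mbasis)
  also have "\<dots> = a (block n) * B0 X (mbasis n)" using assms by simp
  finally show ?thesis
    unfolding frame_eq[OF assms] linear_scale[OF linear_metric_right] B0_commute[of X] B0_scale_left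
    by simp
qed

lemma metric_frame_scaleR_frame:
  assumes "n \<in> {1..7}"
  shows "g X (e n) *\<^sub>R e n = (B0 X (mbasis n) / sqnorm n) *\<^sub>R mbasis n"
proof -
  have "sqrt (b n) * sqrt (b n) = a (block n) * sqnorm n" 
    using b_pos[OF assms] by (simp add: b_def)
  moreover have "a (block n) > 0" using b_pos[OF assms] sqnorm_pos[of n] by (simp add: b_def zero_less_mult_iff)
  ultimately show ?thesis
    unfolding metric_frame[OF assms] unfolding frame_eq[OF assms] B0_commute[of X] B0_scale_left
    using b_pos[OF assms] by (simp add: b_def)
qed

lemma frame_expansion: "(\<Sum>n=1..7. g X (e n) *\<^sub>R e n) = B0_proj \<mm> X"
  unfolding B0_proj_\<mm> by (intro sum.cong refl metric_frame_scaleR_frame)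

lemma frame_in_\<mm>: "n \<in> {1..7} \<Longrightarrow> e n \<in> \<mm>"
  by (simp add: frame_eq \<mm>_eq_span span_scale span_base)

lemma subspace_\<mm>: "subspace \<mm>" by (simp add: \<mm>_eq_span)

lemma frame_expansion_\<mm>:
  assumes "X \<in> \<mm>"
  shows "X = (\<Sum>n=1..7. g X (e n) *\<^sub>R e n)"
proof -
  have "X = (\<Sum>n=1..7. (B0 X (mbasis n) / B0 (mbasis n) (mbasis n)) *\<^sub>R mbasis n)"
    using assms unfolding \<mm>_eq_span
    by (rule orthogonal_expansion[rotated -1]) (auto simp: B0_mbasis_mbasis sqnorm_pos)
  also have "\<dots> = (\<Sum>n=1..7. g X (e n) *\<^sub>R e n)"
    by (intro sum.cong) (auto simp: B0_mbasis_mbasis metric_frame_scaleR_frame)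
  finally show ?thesis .
qed

lemma frame_orthonormal:
  assumes "m \<in> {1..7}" "n \<in> {1..7}"
  shows "g (e m) (e n) = (if m = n then 1 else 0)"
proof -
  have "sqrt (b n) * sqrt (b n) = a (block n) * sqnorm n" 
    using b_pos[OF assms(2)] by (simp add: b_def)
  then show ?thesis
    using b_pos[OF assms(2)]
    unfolding metric_frame[OF assms(2)] unfolding frame_eq[OF assms(1)] frame_eq[OF assms(2)]
    by (auto simp: B0_scale_left B0_scale_right B0_mbasis_mbasis[OF assms] b_def)
qed

lemma metric_sum_frame:
  assumes "n \<in> {1..7}"
  shows "g (\<Sum>m=1..7. c m *\<^sub>R e m) (e n) = c n"
proof -
  have "g (\<Sum>m=1..7. c m *\<^sub>R e m) (e n) = (\<Sum>m=1..7. c m * g (e m) (e n))"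
    by (simp add: linear_sum[OF linear_metric_left] linear_scale[OF linear_metric_left])
  also have "\<dots> = (\<Sum>m=1..7. if m = n then c n else 0)"
    using assms by (intro sum.cong) (auto simp: frame_orthonormal)
  finally show ?thesis using assms by simp
qed

lemma metric_eq_frame: "g X Y = (\<Sum>n=1..7. g X (e n) * g Y (e n))"
proof -
  have "g X Y = g X (\<Sum>n=1..7. g Y (e n) *\<^sub>R e n)"
    by (simp add: frame_expansion metric_proj_\<mm>)
  also have "\<dots> = (\<Sum>n=1..7. g X (e n) * g Y (e n))"
    by (simp add: linear_sum[OF linear_metric_right] linear_scale[OF linear_metric_right] mult.commute)
  finally show ?thesis .
qed

section \<open>The Levi-Civita map in the frame\<close>

text \<open>The condition on \<open>U_map a X Y\<close> is an equation between linear functionals of \<open>Z\<close>, so its value on each frame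
  vector is a coordinate of the solution.\<close>

lemma U_map_eq:
  "U_map a X Y = (\<Sum>n=1..7. ((g (bracket (e n) X) Y + g X (bracket (e n) Y)) / 2) *\<^sub>R e n)"
    (is "_ = ?U")
  unfolding U_map_def
proof (rule the_equality)
  have "2 * g ?U Z = g (bracket Z X) Y + g X (bracket Z Y)" if "Z \<in> \<mm>" for Z
  proof -
    let ?f = "\<lambda>Z. g (bracket Z X) Y + g X (bracket Z Y)"
    have lin: "linear ?f"
      using linear_compose[OF linear_bracket_left linear_metric_left]
        linear_compose[OF linear_bracket_left linear_metric_right]
      by (intro linear_compose_add) (auto simp: o_def)
    have "?f Z = ?f (\<Sum>n=1..7. g Z (e n) *\<^sub>R e n)"
      using frame_expansion_\<mm>[OF that] by simp
    also have "\<dots> = (\<Sum>n=1..7. g Z (e n) * ?f (e n))"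
      by (simp only: linear_sum[OF lin] linear_scale[OF lin] real_scaleR_def)
    also have "\<dots> = 2 * (\<Sum>n=1..7. g ?U (e n) * g Z (e n))"
      unfolding sum_distrib_left by (intro sum.cong refl) (simp add: metric_sum_frame)
    also have "\<dots> = 2 * g ?U Z" by (simp flip: metric_eq_frame)
    finally show ?thesis ..
  qed
  moreover have "?U \<in> \<mm>"
    by (intro subspace_sum subspace_\<mm> subspace_scale frame_in_\<mm>)
  ultimately show U: "?U \<in> \<mm> \<and> (\<forall>Z\<in>\<mm>. 2 * g ?U Z =
      g (B0_proj \<mm> (bracket Z X)) Y + g X (B0_proj \<mm> (bracket Z Y)))"
    by (simp add: metric_proj_\<mm>)
  fix V assume V: "V \<in> \<mm> \<and> (\<forall>Z\<in>\<mm>. 2 * g V Z =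
      g (B0_proj \<mm> (bracket Z X)) Y + g X (B0_proj \<mm> (bracket Z Y)))"
  have "g V (e n) = g ?U (e n)" if "n \<in> {1..7}" for n
  proof -
    have "2 * g V (e n) = 2 * g ?U (e n)"
      using bspec[OF conjunct2[OF U] frame_in_\<mm>[OF that]]
        bspec[OF conjunct2[OF V] frame_in_\<mm>[OF that]] by (rule trans[OF _ sym, rotated])
    then show ?thesis by simp
  qed
  then have "(\<Sum>n=1..7. g V (e n) *\<^sub>R e n) = (\<Sum>n=1..7. g ?U (e n) *\<^sub>R e n)"
    by (intro sum.cong) auto
  then show "V = ?U"
    unfolding frame_expansion_\<mm>[OF conjunct1[OF U], symmetric]
      frame_expansion_\<mm>[OF conjunct1[OF V], symmetric] .
qed

lemma Lambda_map_koszul: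
  assumes "n \<in> {1..7}"
  shows "g (Lambda_map a X Y) (e n) =
    (g (bracket X Y) (e n) + g (bracket (e n) X) Y + g X (bracket (e n) Y)) / 2"
  unfolding Lambda_map_def U_map_eq
  by (simp add: linear_add[OF linear_metric_left] linear_scale[OF linear_metric_left]
      metric_sum_frame[OF assms] metric_proj_\<mm> add_divide_distrib)

text \<open>In each of the three terms of the Koszul formula one argument of the metric is a frame vector, which
  turns the metric into a multiple of \<open>B0\<close>; all three are then multiples of the same value of
  the alternating form \<open>B0 (bracket X Y) Z\<close>.\<close>

lemma Lambda_map_frame:
  assumes "i \<in> {1..7}" "m \<in> {1..7}" "n \<in> {1..7}"
  shows "g (Lambda_map a (e i) (e m)) (e n) =
    (a (block m) + a (block n) - a (block i)) / 2 * B0 (bracket (e i) (e m)) (e n)"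
proof -
  let ?T = "B0 (bracket (e i) (e m)) (e n)"
  have "B0 (bracket (e n) (e i)) (e m) = ?T"
    unfolding B0_bracket[of "e n"] by (rule B0_commute)
  moreover have "B0 (bracket (e n) (e m)) (e i) = - ?T"
    unfolding B0_bracket[of "e n"] B0_commute[of "e n"] bracket_commute[of "e m" "e i"] B0_scale_left
    by simp
  ultimately show ?thesis
    unfolding Lambda_map_koszul[OF assms(3)]
    unfolding metric_commute[of a "e i"]
      metric_frame[OF assms(1)] metric_frame[OF assms(2)] metric_frame[OF assms(3)]
    by (simp add: field_simps)
qed

end

section \<open>Clifford multiplication on the monomial basis\<close>

text \<open>The index type \<open>3\<close> is the integers modulo 3, so that the generator \<open>y\<^sub>3\<close> has index \<open>0\<close> and comes
  first in the order in which monomials are encoded.\<close>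

lemma order_three: "(0::3) < 1" "(0::3) < 2" "(1::3) < 2"
proof -
  have "Rep_bit1 (1 + 1 :: 3) = 2"
    unfolding plus_bit1_def Abs_bit1'_def
    by (subst Abs_bit1_inverse) (simp_all add: bit1.Rep_1)
  then have "Rep_bit1 (2 :: 3) = 2" by simp
  then show "(0::3) < 1" "(0::3) < 2" "(1::3) < 2"
    by (simp_all add: less_bit1_def bit1.Rep_0 bit1.Rep_1)
qed

lemma not_order_three: "\<not> (1::3) < 0" "\<not> (2::3) < 0" "\<not> (2::3) < 1"
  using order_three by (simp_all add: not_less less_imp_le)

lemma contract_axis:
  "contract j (axis S c) =
    (if j \<in> S then axis (S - {j}) ((- 1) ^ card (S \<inter> {..<j}) * c) else 0)"
proof (rule vec_eq_iff[THEN iffD2], rule allI)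
  fix R
  have eq: "insert j R = S \<longleftrightarrow> j \<in> S \<and> R = S - {j}" if "j \<notin> R" using that by blast
  have "{p \<in> R. p < j} = S \<inter> {..<j}" if "insert j R = S" using that by auto
  with eq show "contract j (axis S c) $ R =
      (if j \<in> S then axis (S - {j}) ((- 1) ^ card (S \<inter> {..<j}) * c) else 0) $ R"
    by (cases "j \<in> R") (auto simp: contract_def axis_def)
qed

lemma gen_wedge_axis:
  fixes j :: "'n::{finite,linorder}"
  shows "gen j \<and>\<^sub>e axis S c =
    (if j \<in> S then 0 else axis (insert j S) ((- 1) ^ card (S \<inter> {..<j}) * c))"
proof (rule vec_eq_iff[THEN iffD2], rule allI)
  fix R :: "'n set"
  let ?s = "\<lambda>T. (- 1) ^ card {(p, q). p \<in> T \<and> q \<in> R - T \<and> q < p} :: complex"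
  have "(gen j \<and>\<^sub>e axis S c) $ R = (\<Sum>T\<in>Pow R. if T = {j} then ?s {j} * axis S c $ (R - {j}) else 0)"
    unfolding wedge_def vec_lambda_beta gen_def by (rule sum.cong) (auto simp: axis_def)
  also have "\<dots> = (if j \<in> R then ?s {j} * axis S c $ (R - {j}) else 0)"
    by (subst sum.delta) auto
  also have "card {(p, q). p \<in> {j} \<and> q \<in> R - {j} \<and> q < p} = card (Pair j ` ((R - {j}) \<inter> {..<j}))"
    by (rule arg_cong[where f = card]) auto
  also have "\<dots> = card ((R - {j}) \<inter> {..<j})"
    by (rule card_image) (auto simp: inj_on_def)
  moreover have eq1: "j \<in> R \<and> R - {j} = S \<longleftrightarrow> j \<notin> S \<and> R = insert j S" by blast
  moreover have eq2: "(insert j S - {j}) \<inter> {..<j} = S \<inter> {..<j}" by auto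
  ultimately show "(gen j \<and>\<^sub>e axis S c) $ R =
      (if j \<in> S then 0 else axis (insert j S) ((- 1) ^ card (S \<inter> {..<j}) * c)) $ R"
    by (cases "j \<in> R \<and> R - {j} = S") (auto simp: axis_def)
qed

lemma grade_inv_axis: "grade_inv (axis S c) = axis S ((- 1) ^ card S * c)"
  by (auto simp: vec_eq_iff grade_inv_def axis_def)

lemma contract_add: "contract j (u + v) = contract j u + contract j v"
  by (auto simp: vec_eq_iff contract_def algebra_simps)

lemma wedge_add_right: "w \<and>\<^sub>e (u + v) = w \<and>\<^sub>e u + w \<and>\<^sub>e v"
  by (auto simp: vec_eq_iff wedge_def algebra_simps sum.distrib)

lemma grade_inv_add: "grade_inv (u + v) = grade_inv u + grade_inv v"
  by (auto simp: vec_eq_iff grade_inv_def algebra_simps)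

lemma contract_scale: "contract j (c *s u) = c *s contract j u"
  by (auto simp: vec_eq_iff contract_def algebra_simps)

lemma wedge_scale_right: "w \<and>\<^sub>e (c *s u) = c *s (w \<and>\<^sub>e u)"
  by (auto simp: vec_eq_iff wedge_def algebra_simps sum_distrib_left)

lemma grade_inv_scale: "grade_inv (c *s u) = c *s grade_inv u"
  by (auto simp: vec_eq_iff grade_inv_def algebra_simps)

lemma cliff_e_add: "cliff_e n (u + v) = cliff_e n u + cliff_e n v"
  by (auto simp: cliff_e_def Let_def contract_add wedge_add_right grade_inv_add vec_eq_iff algebra_simps)

lemma cliff_e_scale: "cliff_e n (c *s u) = c *s cliff_e n u"
  by (auto simp: cliff_e_def Let_def contract_scale wedge_scale_right grade_inv_scale vec_eq_iff algebra_simps)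

lemma axis_add: "axis S a + axis S b = axis S ((a::complex) + (b::complex))"
  by (simp add: vec_eq_iff axis_def)

lemma axis_minus: "- axis S (a::complex) = axis S (- a)"
  by (auto simp: vec_eq_iff axis_def)

lemma axis_scale: "c *s axis S b = axis S (c * (b::complex))"
  by (simp add: vec_eq_iff axis_def)

lemma diff_axis: "u - axis S (c::complex) = u + axis S (- c)"
  by (simp add: axis_minus[symmetric])

lemma three_eq_zero: "(3::3) = 0" by simp

lemmas spin_simps = cliff_e_def gen_wedge_axis contract_axis grade_inv_axis axis_scale axis_minus
   axis_add order_three not_order_three Int_insert_left insert_Diff_if
   three_eq_zero

lemma psi_axis: "psi k = complex_of_real (1 / sqrt 2) *s
    (if k = 0 then axis {2,0} (- 1) + axis {1} \<i>
     else if k = 1 then axis {2,0} (- \<i>) + axis {1} 1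
     else if k = 2 then axis {} (- 1) + axis {1,2,0} \<i>
     else axis {} (- \<i>) + axis {1,2,0} 1)"
proof -
  have w: "\<omega> = axis {2,0} (- 1)"
    unfolding \<omega>_def gen_def[of 3] by (simp add: spin_simps)
  have w': "y_gen 1 \<and>\<^sub>e \<omega> = axis {1,2,0} 1"
    unfolding w by (simp add: spin_simps)
  show ?thesis unfolding psi_def w' unfolding w gen_def ext_one_def axis_scale axis_minus by simp
qed

section \<open>The lines of the Fano plane\<close>

text \<open>Minus the eigenvalue of \<open>e\<^sub>p e\<^sub>m e\<^sub>n\<close> on \<open>psi k\<close>, for the lines \<open>(p,m,n)\<close> that join \<open>p \<in> {1,2,3}\<close> to a
  pair from \<open>{4,5,6,7}\<close>, in the order for which the structure constant is positive.\<close>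

definition sgn_line :: "nat \<Rightarrow> nat \<Rightarrow> real" where
  "sgn_line k p = (if k = 0 \<or> k = p then - 1 else 1)"

text \<open>One equation for each point \<open>i\<close> of each line \<open>(i,m,n)\<close>, with \<open>m < n\<close> as in \<open>spin_lift\<close>; a minus
  sign marks the orders in which the structure constant is negative. Each spinor has two
  monomials, and \<open>e\<^sub>m e\<^sub>n\<close> carries them to multiples of the same two monomials as \<open>e\<^sub>i\<close> does, possibly
  interchanged, so the proof only compares coefficients.\<close>

lemma fano_lines:
  assumes "k \<in> {0,1,2,3}"
  shows "cliff_e 2 (cliff_e 3 (psi k)) = cliff_e 1 (psi k)"
    "cliff_e 4 (cliff_e 5 (psi k)) = sgn_line k 1 *\<^sub>R cliff_e 1 (psi k)"
    "cliff_e 6 (cliff_e 7 (psi k)) = sgn_line k 1 *\<^sub>R cliff_e 1 (psi k)"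
    "cliff_e 1 (cliff_e 3 (psi k)) = - cliff_e 2 (psi k)"
    "cliff_e 4 (cliff_e 6 (psi k)) = sgn_line k 2 *\<^sub>R cliff_e 2 (psi k)"
    "cliff_e 5 (cliff_e 7 (psi k)) = - sgn_line k 2 *\<^sub>R cliff_e 2 (psi k)"
    "cliff_e 1 (cliff_e 2 (psi k)) = cliff_e 3 (psi k)"
    "cliff_e 4 (cliff_e 7 (psi k)) = sgn_line k 3 *\<^sub>R cliff_e 3 (psi k)"
    "cliff_e 5 (cliff_e 6 (psi k)) = sgn_line k 3 *\<^sub>R cliff_e 3 (psi k)"
    "cliff_e 1 (cliff_e 5 (psi k)) = - sgn_line k 1 *\<^sub>R cliff_e 4 (psi k)"
    "cliff_e 2 (cliff_e 6 (psi k)) = - sgn_line k 2 *\<^sub>R cliff_e 4 (psi k)"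
    "cliff_e 3 (cliff_e 7 (psi k)) = - sgn_line k 3 *\<^sub>R cliff_e 4 (psi k)"
    "cliff_e 1 (cliff_e 4 (psi k)) = sgn_line k 1 *\<^sub>R cliff_e 5 (psi k)"
    "cliff_e 2 (cliff_e 7 (psi k)) = sgn_line k 2 *\<^sub>R cliff_e 5 (psi k)"
    "cliff_e 3 (cliff_e 6 (psi k)) = - sgn_line k 3 *\<^sub>R cliff_e 5 (psi k)"
    "cliff_e 1 (cliff_e 7 (psi k)) = - sgn_line k 1 *\<^sub>R cliff_e 6 (psi k)"
    "cliff_e 2 (cliff_e 4 (psi k)) = sgn_line k 2 *\<^sub>R cliff_e 6 (psi k)"
    "cliff_e 3 (cliff_e 5 (psi k)) = sgn_line k 3 *\<^sub>R cliff_e 6 (psi k)"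
    "cliff_e 1 (cliff_e 6 (psi k)) = sgn_line k 1 *\<^sub>R cliff_e 7 (psi k)"
    "cliff_e 2 (cliff_e 5 (psi k)) = - sgn_line k 2 *\<^sub>R cliff_e 7 (psi k)"
    "cliff_e 3 (cliff_e 4 (psi k)) = sgn_line k 3 *\<^sub>R cliff_e 7 (psi k)"
  using assms
  by (elim insertE emptyE; hypsubst; (simp add: psi_axis cliff_e_add cliff_e_scale sgn_line_def;
      (simp add: spin_simps diff_axis insert_commute add.commute)?))+

lemma bracket_entries:
  "bracket X Y $ r $ c = X $ r $ 1 * Y $ 1 $ c + X $ r $ 2 * Y $ 2 $ c
     - (Y $ r $ 1 * X $ 1 $ c + Y $ r $ 2 * X $ 2 $ c)"
  by (simp add: bracket_def matrix_matrix_mult_def sum_2)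

definition structure_const :: "nat \<Rightarrow> nat \<Rightarrow> nat \<Rightarrow> real" where
  "structure_const i m n = B0 (bracket (mbasis i) (mbasis m)) (mbasis n)"

lemmas structure_const_eval = structure_const_def B0_mbasis bracket_entries mbasis_entries

lemma sum_pairs: "(\<Sum>n=1..7::nat. \<Sum>m=1..<n. f m n) =
    (f 1 2 + f 1 3 + f 2 3 + f 1 4 + f 2 4 + f 3 4 + f 1 5 + f 2 5 + f 3 5 + f 4 5
     + f 1 6 + f 2 6 + f 3 6 + f 4 6 + f 5 6
     + f 1 7 + f 2 7 + f 3 7 + f 4 7 + f 5 7 + f 6 7 :: 'a :: comm_monoid_add)"
  by (simp add: numeral_eq_Suc One_nat_def add_ac)

text \<open>The case distinction in the eigenvalues is the sign of the lines: \<open>sgn_line\<close> multiplies exactly the terms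
  that come from lines meeting \<open>{4,5,6,7}\<close>.\<close>

lemma lam_eq:
  assumes "k \<in> {0,1,2,3}"
  shows "p \<in> {1,2,3} \<Longrightarrow> lam a k p = (- Theta a p (cyc (p + 1)) (cyc (p + 2))
                       + Theta a (cyc (p + 1)) p (cyc (p + 2))
                       + Theta a (cyc (p + 2)) p (cyc (p + 1))) / 2
      + sgn_line k p * (Theta a 4 p 4 - Theta a p 4 4)"
    and "lam a k 4 = (sgn_line k 1 * Theta a 1 4 4 + sgn_line k 2 * Theta a 2 4 4
      + sgn_line k 3 * Theta a 3 4 4) / 2"
  using assms by (auto simp: lam_def sgn_line_def cyc_def field_simps)

section \<open>Covariant derivative and invariance of the spinors\<close>

context invariant_metric
begin

lemma nabla_frame:
  assumes "i \<in> {1..7}"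
  shows "nabla a (e i) \<psi> = (\<Sum>n=1..7. \<Sum>m=1..<n.
    ((a (block m) + a (block n) - a (block i)) / 4 * structure_const i m n / (sqrt (b i) * sqrt (b m) * sqrt (b n)))
     *\<^sub>R cliff_e m (cliff_e n \<psi>))"
  unfolding nabla_def spin_lift_def
proof (intro sum.cong refl)
  fix n m :: nat assume n: "n \<in> {1..7}" and "m \<in> {1..<n}"
  then have m: "m \<in> {1..7}" by auto
  have "B0 (bracket (e i) (e m)) (e n) = structure_const i m n / (sqrt (b i) * sqrt (b m) * sqrt (b n))"
    unfolding frame_eq[OF assms] frame_eq[OF m] frame_eq[OF n] structure_const_def
    by (simp add: B0_scale_left B0_scale_right linear_scale[OF linear_bracket_left]
        linear_scale[OF linear_bracket_right])
  then show "(g (Lambda_map a (e i) (e m)) (e n) / 2) *\<^sub>R cliff_e m (cliff_e n \<psi>) =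
    ((a (block m) + a (block n) - a (block i)) / 4 * structure_const i m n / (sqrt (b i) * sqrt (b m) * sqrt (b n)))
     *\<^sub>R cliff_e m (cliff_e n \<psi>)"
    by (simp add: Lambda_map_frame[OF assms m n])
qed

text \<open>Of the 21 terms only those of the three lines through the point \<open>n\<close> survive. If \<open>n\<close> is in \<open>{1,2,3}\<close>,
  then the line \<open>{1,2,3}\<close> gives the first summand of \<open>lam_eq\<close> and the other two lines, with equal
  coefficients, give the second. If \<open>n\<close> is in \<open>{4,5,6,7}\<close>, then the three lines are those that join it
  to 1, 2 and 3; each has one further point with parameter \<open>a 4\<close>, which cancels that of \<open>n\<close>
  and leaves a single \<open>Theta\<close>.\<close>

lemma nabla_frame_psi:
  assumes k: "k \<in> {0,1,2,3}" and n: "n \<in> {1..7}"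
  shows "nabla a (e n) (psi k) = lam a k (block n) *\<^sub>R cliff_e n (psi k)"
proof -
  (* The square roots of the parameters, in which the coefficients are rational functions. *)
  define s where "s r = (if r = 4 then sqrt (2 * a 4) else sqrt (a r))" for r :: nat
  have s: "s 1 \<noteq> 0" "s 2 \<noteq> 0" "s 3 \<noteq> 0" "s 4 \<noteq> 0"
    using a_pos[of 1] a_pos[of 2] a_pos[of 3] a_pos[of 4] by (simp_all add: s_def)
  have as: "a 1 = (s 1)\<^sup>2" "a 2 = (s 2)\<^sup>2" "a 3 = (s 3)\<^sup>2" "a 4 = (s 4)\<^sup>2 / 2"
    using a_pos[of 1] a_pos[of 2] a_pos[of 3] a_pos[of 4] by (simp_all add: s_def)
  have bs: "sqrt (b 1) = s 1" "sqrt (b 2) = s 2" "sqrt (b 3) = s 3" "sqrt (b 4) = s 4"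
    "sqrt (b 5) = s 4" "sqrt (b 6) = s 4" "sqrt (b 7) = s 4"
    by (simp_all add: s_def b_def block_def sqnorm_def mult.commute)
  have Theta: "Theta a l m n = s l / (s m * s n)" for l m n
    by (simp add: Theta_def b_coeff_def s_def real_sqrt_divide real_sqrt_mult)
  have blk: "block 1 = 1" "block 2 = 2" "block 3 = 3" "block 4 = 4" "block 5 = 4" "block 6 = 4" "block 7 = 4"
    by (simp_all add: block_def)
  have cyc: "cyc 2 = 2" "cyc 3 = 3" "cyc 4 = 1" "cyc 5 = 2"
    by (simp_all add: cyc_def)
  have one: "(1::nat) \<in> {1,2,3}" "(2::nat) \<in> {1,2,3}" "(3::nat) \<in> {1,2,3}" by auto
  note lams = lam_eq(1)[OF k one(1)] lam_eq(1)[OF k one(2)] lam_eq(1)[OF k one(3)] lam_eq(2)[OF k]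
  show ?thesis
    unfolding nabla_frame[OF n] sum_pairs
    by (insert n[unfolded atLeastAtMost_1_7], elim insertE emptyE, (hypsubst,
        simp add: structure_const_eval fano_lines[OF k] blk bs flip: scaleR_add_left scaleR_diff_left,
        rule disjI1, simp add: lams Theta cyc as s, simp add: s field_simps power2_eq_square)+)
qed

text \<open>The lower right entry of \<open>H\<close> is imaginary, and each of its three coordinates is the coefficient
  of two products \<open>e\<^sub>m e\<^sub>n\<close> with indices in \<open>{4,5,6,7}\<close>. On \<open>psi k\<close> both are multiples of the same
  \<open>e\<^sub>p\<close>, and the multiples are opposite.\<close>

lemma invariant_psi:
  assumes k: "k \<in> {0,1,2,3}"
  shows "invariant_spinor a (psi k)"
  unfolding invariant_spinor_def
proof
  fix H assume H: "H \<in> \<hh>"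
  have coeff: "g (bracket H (e m)) (e n) =
      a (block n) * B0 (bracket H (mbasis m)) (mbasis n) / (sqrt (b m) * sqrt (b n))"
    if m: "m \<in> {1..7}" and n: "n \<in> {1..7}" for m n
    unfolding metric_frame[OF n] unfolding frame_eq[OF m] frame_eq[OF n]
    by (simp add: B0_scale_left B0_scale_right linear_scale[OF linear_bracket_right])
  have bs: "b 4 = 2 * a 4" "b 5 = 2 * a 4" "b 6 = 2 * a 4" "b 7 = 2 * a 4"
    by (simp_all add: b_def block_def sqnorm_def)
  have blk: "block 4 = 4" "block 5 = 4" "block 6 = 4" "block 7 = 4"
    by (simp_all add: block_def)
  have "spin_lift a (bracket H) (psi k) =
      (\<Sum>n=1..7. \<Sum>m=1..<n. (a (block n) * B0 (bracket H (mbasis m)) (mbasis n) / (sqrt (b m) * sqrt (b n)) / 2)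
        *\<^sub>R cliff_e m (cliff_e n (psi k)))"
    unfolding spin_lift_def by (intro sum.cong refl) (simp add: coeff)
  also have "\<dots> = 0"
    unfolding sum_pairs using \<hh>_entries[OF H] a_pos[of 4]
    by (simp add: B0_mbasis bracket_entries mbasis_entries fano_lines[OF k] bs blk)
  finally show "spin_lift a (bracket H) (psi k) = 0" .
qed

lemma linear_nabla: "linear (\<lambda>X. nabla a X \<psi>)"
proof -
  have lin: "linear (\<lambda>X. g (Lambda_map a X (e m)) (e n))" if "n \<in> {1..7}" for m n
    unfolding Lambda_map_koszul[OF that]
    by (rule linearI)
      (simp_all add: linear_add[OF linear_bracket_left] linear_add[OF linear_bracket_right]
        linear_scale[OF linear_bracket_left] linear_scale[OF linear_bracket_right]
        linear_add[OF linear_metric_left] linear_scale[OF linear_metric_left] field_simps)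
  show ?thesis
    unfolding nabla_def spin_lift_def
    by (rule linearI)
      (simp_all add: linear_add[OF lin] linear_scale[OF lin] add_divide_distrib scaleR_add_left
        sum.distrib scaleR_sum_right)
qed

lemma linear_cliff: "linear (\<lambda>X. cliff a X \<psi>)"
  unfolding cliff_def
  by (rule linearI)
    (simp_all add: linear_add[OF linear_metric_left] linear_scale[OF linear_metric_left]
      scaleR_add_left sum.distrib scaleR_sum_right)

lemma cliff_frame:
  assumes "n \<in> {1..7}"
  shows "cliff a (e n) \<psi> = cliff_e n \<psi>"
proof -
  have "cliff a (e n) \<psi> = (\<Sum>m=1..7. if m = n then cliff_e n \<psi> else 0)"
    unfolding cliff_def using assms by (intro sum.cong) (auto simp: frame_orthonormal)
  then show ?thesis using assms by simp
qed

lemma A_endo_eq: "A_endo a k X = (\<Sum>n=1..7. (lam a k (block n) * g X (e n)) *\<^sub>R e n)"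
proof -
  have "lam a k r *\<^sub>R B0_proj (\<mm>_part r) X =
      (\<Sum>n | n \<in> {1..7} \<and> block n = r. (lam a k (block n) * g X (e n)) *\<^sub>R e n)"
    if "r \<in> {1..4}" for r
    unfolding B0_proj_\<mm>_part[OF that] scaleR_sum_right
    by (rule sum.cong[OF refl]) (simp add: metric_frame_scaleR_frame flip: scaleR_scaleR)
  then have "A_endo a k X = (\<Sum>r=1..4. \<Sum>n | n \<in> {1..7} \<and> block n = r.
      (lam a k (block n) * g X (e n)) *\<^sub>R e n)"
    unfolding A_endo_def by (intro sum.cong) auto
  then show ?thesis by (simp only: sum_over_blocks)
qed

lemma linear_A_endo: "linear (A_endo a k)"
  unfolding A_endo_eq[abs_def]
  by (rule linearI)
    (simp_all add: linear_add[OF linear_metric_left] linear_scale[OF linear_metric_left]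
      distrib_left scaleR_add_left sum.distrib scaleR_sum_right mult_ac)

lemma A_endo_frame:
  assumes "n \<in> {1..7}"
  shows "A_endo a k (e n) = lam a k (block n) *\<^sub>R e n"
proof -
  have "A_endo a k (e n) = (\<Sum>m=1..7. if m = n then lam a k (block n) *\<^sub>R e n else 0)"
    unfolding A_endo_eq using assms by (intro sum.cong) (auto simp: frame_orthonormal)
  then show ?thesis using assms by simp
qed

lemma symmetric_A_endo: "symmetric_endo a (A_endo a k)"
proof -
  have in_\<mm>: "A_endo a k X \<in> \<mm>" for X
    unfolding A_endo_eq by (intro subspace_sum subspace_\<mm> subspace_scale frame_in_\<mm>)
  have diag: "g (A_endo a k X) Y = (\<Sum>n=1..7. lam a k (block n) * (g X (e n) * g Y (e n)))" for X Y
  proof -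
    have "g (A_endo a k X) (e n) = lam a k (block n) * g X (e n)" if "n \<in> {1..7}" for n
      unfolding A_endo_eq by (rule metric_sum_frame[OF that])
    then show ?thesis
      unfolding metric_eq_frame[of "A_endo a k X" Y] by (intro sum.cong) auto
  qed
  have "g (A_endo a k X) Y = g X (A_endo a k Y)" for X Y
    unfolding metric_commute[of a X "A_endo a k Y"] diag
    by (intro sum.cong refl arg_cong2[where f = times] mult.commute)
  then show ?thesis
    unfolding symmetric_endo_def
    using in_\<mm> linear_add[OF linear_A_endo] linear_scale[OF linear_A_endo] by blast
qed

lemma nabla_psi:
  assumes k: "k \<in> {0,1,2,3}" and "X \<in> \<mm>"
  shows "nabla a X (psi k) = cliff a (A_endo a k X) (psi k)"
proof -
  have lin: "linear (\<lambda>X. cliff a (A_endo a k X) (psi k))"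
    using linear_compose[OF linear_A_endo linear_cliff] by (simp add: o_def)
  have "nabla a (e n) (psi k) = cliff a (A_endo a k (e n)) (psi k)" if n: "n \<in> {1..7}" for n
  proof -
    have "nabla a (e n) (psi k) = lam a k (block n) *\<^sub>R cliff_e n (psi k)"
      by (rule nabla_frame_psi[OF k n])
    then show ?thesis
      by (simp add: A_endo_frame[OF n] linear_scale[OF linear_cliff] cliff_frame[OF n])
  qed
  then have on_frame: "nabla a Z (psi k) = cliff a (A_endo a k Z) (psi k)" if "Z \<in> e ` {1..7}" for Z
    using that by blast
  have "(\<Sum>n=1..7. g X (e n) *\<^sub>R e n) \<in> span (e ` {1..7})"
    by (intro span_sum span_scale span_base imageI)
  then have "X \<in> span (e ` {1..7})"
    unfolding frame_expansion_\<mm>[OF assms(2), symmetric] .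
  with on_frame show ?thesis
    by (rule linear_eq_on_span[OF linear_nabla lin])
qed

end

theorem proposition4p22:
  fixes a :: "nat \<Rightarrow> real"
  assumes "\<forall>r\<in>{1..4}. a r > 0"
  shows "\<forall>k\<in>{0..3}. generalized_killing_with a (A_endo a k) (psi k)"
proof
  fix k :: nat assume "k \<in> {0..3}"
  then have k: "k \<in> {0, 1, 2, 3}" by auto
  interpret invariant_metric a using assms by unfold_locales blast
  show "generalized_killing_with a (A_endo a k) (psi k)"
    unfolding generalized_killing_with_def
    using invariant_psi[OF k] symmetric_A_endo nabla_psi[OF k] by blast
qed

end
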